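(* Let $\mathcal H=(M,S,X,\Delta)$ be a smooth hybrid dynamical system with $M$ compact, having the boundary identity property. If $\mathcal H$ preserves a smooth measure $\mu$, then $\mu(\mathcal N)=0$, where $$\mathcal N=\Bigl\{x\in M:\ \exists\,t>0\ \text{such that}\ \lim_{s\to t^-}\varphi_s^{\mathcal H}(x)\in\mathcal Z\Bigr\},\qquad \mathcal Z=\overline S\cap\overline{\Delta(S)}.$$
   Context: A hybrid dynamical system is a 4-tuple $\mathcal H=(M,S,X,\Delta)$ such that (H.1) $M$ is a smooth finite-dimensional manifold; (H.2) $S\subset M$ is a smooth embedded submanifold of codimension 1; (H.3) $X:M\to TM$ is a smooth vector field; (H.4) $\Delta:S\to M$ is a smooth map whose image is an embedded submanifold; (H.5) $S\cap\Delta(S)=\emptyset$ and $\overline S\cap\overline{\Delta(S)}$ has codimension at least 2. Smooth means $C^\infty$. Hybrid flow: let $\varphi$ be the flow of $\dot x=X(x)$. The hybrid flow $\varphi^{\mathcal H}$ satisfies $\varphi^{\mathcal H}(t,x)=\varphi(t,x)$ if $\varphi(s,x)\notin S$ for all $s\in[0,t]$; and if $\varphi(s,x)\notin S$ for $s\in[0,t)$ but $\varphi(t,x)\in S$, then $\lim_{s\to t^+}\varphi^{\mathcal H}(s,x)=\Delta(\lim_{s\to t^-}\varphi^{\mathcal H}(s,x))$, after which the continuous flow resumes (and so on). $\mathcal H$ is called smooth if in addition (A.1) whenever $\varphi^{\mathcal H}(t,x)\in\overline S\setminus S$ there is $\varepsilon>0$ such that $\varphi^{\mathcal H}(t+\delta,x)\notin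 S$ for all $0<\delta<\varepsilon$; and (A.2) $T_xM=T_xS\oplus X(x)\mathbb R$ for all $x\in S$. For a smooth $\mathcal H$, $\varphi^{\mathcal H}_t$ is smooth near every $x\in M\setminus S$ with $\varphi^{\mathcal H}_t(x)\notin S$ (known fact). Boundary identity property: for any sequence $\{s_n\}\subset S$ with $s_n\to s\in\mathcal Z$ one has $\Delta(s_n)\to s$. Completed flow: if $\lim_{s\to t^-}\varphi^{\mathcal H}_s(x_0)=z_0\in\mathcal Z$, one sets $\varphi_t^{\mathcal H}(x_0)=z_0$ and continues by $\varphi^{\mathcal H}_{t+\delta}(x_0)=\varphi_\delta(z_0)$ for those small $\delta>0$ (which exist by (A.1)) for which $\varphi$ has not returned to $S$; (A.1) is used at the points of $\mathcal Z$ in this sense, i.e. for $z\in\mathcal Z$ there is $\varepsilon>0$ with $\varphi_t(z)\notin S$ for $t\in(0,\varepsilon)$. A smooth measure is one given by a smooth volume form (smooth positive density); $\mathcal H$ preserves it if it is invariant under the hybrid flow. *)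

theory Defs
  imports "HOL-Analysis.Analysis"
begin

section \<open>Smooth manifolds\<close>

text \<open>\<open>Ck_on k U f\<close>: the map \<open>f\<close> is \<open>k\<close> times continuously differentiable on the open set \<open>U\<close>.\<close>

primrec Ck_on ::
  "nat \<Rightarrow> 'b::euclidean_space set \<Rightarrow> ('b \<Rightarrow> 'c::euclidean_space) \<Rightarrow> bool" where
  "Ck_on 0 U f \<longleftrightarrow> continuous_on U f"
| "Ck_on (Suc k) U f \<longleftrightarrow> (\<forall>x\<in>U. f differentiable (at x)) \<and>
     (\<forall>v. Ck_on k U (\<lambda>x. frechet_derivative f (at x) v))"

definition smooth_on :: "'b::euclidean_space set \<Rightarrow> ('b \<Rightarrow> 'c::euclidean_space) \<Rightarrow> bool" where
  "smooth_on U f \<longleftrightarrow> (\<forall>k. Ck_on k U f)"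

text \<open>The underlying space of a manifold is a whole Hausdorff, second countable type \<open>'a\<close>, and
  \<open>'b\<close> is the model space, of dimension \<open>DIM('b)\<close>. A chart is a pair of an open domain and a
  coordinate map; the values of the coordinate map outside the domain are irrelevant.\<close>

type_synonym ('a, 'b) chart = "'a set \<times> ('a \<Rightarrow> 'b)"

abbreviation chart_dom :: "('a, 'b) chart \<Rightarrow> 'a set" where
  "chart_dom c \<equiv> fst c"

abbreviation coord :: "('a, 'b) chart \<Rightarrow> 'a \<Rightarrow> 'b" where
  "coord c \<equiv> snd c"

definition chart_inv :: "('a, 'b) chart \<Rightarrow> 'b \<Rightarrow> 'a" where
  "chart_inv c = inv_into (chart_dom c) (coord c)"

definition is_chart ::
  "('a::{t2_space, second_countable_topology}, 'b::euclidean_space) chart \<Rightarrow> bool" where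
  "is_chart c \<longleftrightarrow> open (chart_dom c) \<and> open (coord c ` chart_dom c) \<and>
     homeomorphism (chart_dom c) (coord c ` chart_dom c) (coord c) (chart_inv c)"

definition transition :: "('a, 'b) chart \<Rightarrow> ('a, 'b) chart \<Rightarrow> 'b \<Rightarrow> 'b" where
  "transition c d = coord d \<circ> chart_inv c"

definition compatible ::
  "('a, 'b::euclidean_space) chart \<Rightarrow> ('a, 'b) chart \<Rightarrow> bool" where
  "compatible c d \<longleftrightarrow>
     smooth_on (coord c ` (chart_dom c \<inter> chart_dom d)) (transition c d) \<and>
     smooth_on (coord d ` (chart_dom c \<inter> chart_dom d)) (transition d c)"

text \<open>A smooth structure is a maximal smooth atlas.\<close>

definition smooth_structure ::
  "('a::{t2_space, second_countable_topology}, 'b::euclidean_space) chart set \<Rightarrow> bool" where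
  "smooth_structure A \<longleftrightarrow>
     (\<forall>c\<in>A. is_chart c) \<and> (\<Union>c\<in>A. chart_dom c) = UNIV \<and>
     (\<forall>c\<in>A. \<forall>d\<in>A. compatible c d) \<and>
     (\<forall>c. is_chart c \<and> (\<forall>d\<in>A. compatible c d) \<longrightarrow> c \<in> A)"

text \<open>Submanifolds are described by slice charts.\<close>

definition embedded_submanifold ::
  "('a::{t2_space, second_countable_topology}, 'b::euclidean_space) chart set
     \<Rightarrow> nat \<Rightarrow> 'a set \<Rightarrow> bool" where
  "embedded_submanifold A k N \<longleftrightarrow>
     (\<forall>p\<in>N. \<exists>c\<in>A. p \<in> chart_dom c \<and>
        (\<exists>L. affine L \<and> aff_dim L = int k \<and>
             coord c ` (chart_dom c \<inter> N) = coord c ` chart_dom c \<inter> L))"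

text \<open>A set that need not be a submanifold itself (e.g. the boundary of a hypersurface, possibly
  with corners) has codimension at least 2 if countably many embedded submanifolds of codimension
  at least 2 cover it.\<close>

definition codim_at_least_2 ::
  "('a::{t2_space, second_countable_topology}, 'b::euclidean_space) chart set
     \<Rightarrow> 'a set \<Rightarrow> bool" where
  "codim_at_least_2 A Z \<longleftrightarrow>
     (\<exists>F. countable F \<and> Z \<subseteq> \<Union>F \<and>
          (\<forall>N\<in>F. \<exists>k. k + 2 \<le> DIM('b) \<and> embedded_submanifold A k N))"

definition smooth_map_open ::
  "('a::{t2_space, second_countable_topology}, 'b::euclidean_space) chart set
     \<Rightarrow> 'a set \<Rightarrow> ('a \<Rightarrow> 'a) \<Rightarrow> bool" where
  "smooth_map_open A U F \<longleftrightarrow> open U \<and> continuous_on U F \<and>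
     (\<forall>c\<in>A. \<forall>d\<in>A.
        smooth_on (coord c ` {p \<in> chart_dom c \<inter> U. F p \<in> chart_dom d})
                  (coord d \<circ> F \<circ> chart_inv c))"

text \<open>A map on an embedded submanifold is smooth iff it has local smooth extensions.\<close>

definition smooth_map_on ::
  "('a::{t2_space, second_countable_topology}, 'b::euclidean_space) chart set
     \<Rightarrow> 'a set \<Rightarrow> ('a \<Rightarrow> 'a) \<Rightarrow> bool" where
  "smooth_map_on A N f \<longleftrightarrow>
     (\<forall>p\<in>N. \<exists>U F. p \<in> U \<and> smooth_map_open A U F \<and> (\<forall>q\<in>U \<inter> N. F q = f q))"


section \<open>Vector fields and flows\<close>

text \<open>A tangent vector at \<open>p\<close> is given by its coordinate representations in all charts around \<open>p\<close>,
  which are related by the derivatives of the transition maps. Accordingly \<open>X c p\<close> is the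
  representation of the vector \<open>X(p)\<close> in the chart \<open>c\<close>, meaningful for \<open>p \<in> chart_dom c\<close>.\<close>

definition smooth_vector_field ::
  "('a::{t2_space, second_countable_topology}, 'b::euclidean_space) chart set
     \<Rightarrow> (('a, 'b) chart \<Rightarrow> 'a \<Rightarrow> 'b) \<Rightarrow> bool" where
  "smooth_vector_field A X \<longleftrightarrow>
     (\<forall>c\<in>A. \<forall>d\<in>A. \<forall>p\<in>chart_dom c \<inter> chart_dom d.
        X d p = frechet_derivative (transition c d) (at (coord c p)) (X c p)) \<and>
     (\<forall>c\<in>A. smooth_on (coord c ` chart_dom c) (X c \<circ> chart_inv c))"

definition integral_curve ::
  "('a::{t2_space, second_countable_topology}, 'b::euclidean_space) chart set
     \<Rightarrow> (('a, 'b) chart \<Rightarrow> 'a \<Rightarrow> 'b) \<Rightarrow> (real \<Rightarrow> 'a) \<Rightarrow> bool" where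
  "integral_curve A X \<gamma> \<longleftrightarrow> continuous_on UNIV \<gamma> \<and>
     (\<forall>t. \<forall>c\<in>A. \<gamma> t \<in> chart_dom c \<longrightarrow>
        ((coord c \<circ> \<gamma>) has_vector_derivative X c (\<gamma> t)) (at t))"

text \<open>The flow is global, as it is for every smooth vector field on a compact manifold.\<close>

definition is_flow ::
  "('a::{t2_space, second_countable_topology}, 'b::euclidean_space) chart set
     \<Rightarrow> (('a, 'b) chart \<Rightarrow> 'a \<Rightarrow> 'b) \<Rightarrow> (real \<Rightarrow> 'a \<Rightarrow> 'a) \<Rightarrow> bool" where
  "is_flow A X \<phi> \<longleftrightarrow> (\<forall>x. \<phi> 0 x = x \<and> integral_curve A X (\<lambda>t. \<phi> t x))"

text \<open>The tangent space of a submanifold \<open>N\<close> at \<open>p\<close>, in the coordinates of \<open>c\<close>: velocities of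
  smooth curves in \<open>N\<close> through \<open>p\<close>.\<close>

definition tangent_coords ::
  "('a, 'b::euclidean_space) chart \<Rightarrow> 'a set \<Rightarrow> 'a \<Rightarrow> 'b set" where
  "tangent_coords c N p =
     {v. \<exists>\<gamma> \<epsilon>. (\<epsilon>::real) > 0 \<and> \<gamma> 0 = p \<and>
            (\<forall>t\<in>{-\<epsilon><..<\<epsilon>}. \<gamma> t \<in> N \<inter> chart_dom c) \<and>
            smooth_on {-\<epsilon><..<\<epsilon>} (coord c \<circ> \<gamma>) \<and>
            ((coord c \<circ> \<gamma>) has_vector_derivative v) (at 0)}"

definition transversal ::
  "('a::{t2_space, second_countable_topology}, 'b::euclidean_space) chart set
     \<Rightarrow> 'a set \<Rightarrow> (('a, 'b) chart \<Rightarrow> 'a \<Rightarrow> 'b) \<Rightarrow> bool" where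
  "transversal A N X \<longleftrightarrow>
     (\<forall>x\<in>N. \<forall>c\<in>A. x \<in> chart_dom c \<longrightarrow>
        {u + v |u v. u \<in> tangent_coords c N x \<and> v \<in> span {X c x}} = UNIV \<and>
        tangent_coords c N x \<inter> span {X c x} = {0})"


section \<open>Hybrid systems\<close>

definition junction :: "'a::topological_space set \<Rightarrow> ('a \<Rightarrow> 'a) \<Rightarrow> 'a set" where
  "junction S \<Delta> = closure S \<inter> closure (\<Delta> ` S)"

definition hybrid_system ::
  "('a::{t2_space, second_countable_topology}, 'b::euclidean_space) chart set
     \<Rightarrow> 'a set \<Rightarrow> (('a, 'b) chart \<Rightarrow> 'a \<Rightarrow> 'b) \<Rightarrow> ('a \<Rightarrow> 'a) \<Rightarrow> bool" where
  "hybrid_system A S X \<Delta> \<longleftrightarrow>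
     smooth_structure A \<and>
     embedded_submanifold A (DIM('b) - 1) S \<and>
     smooth_vector_field A X \<and>
     smooth_map_on A S \<Delta> \<and> (\<exists>k. embedded_submanifold A k (\<Delta> ` S)) \<and>
     S \<inter> \<Delta> ` S = {} \<and> codim_at_least_2 A (junction S \<Delta>)"

text \<open>\<open>hybrid_arc S \<phi> \<Delta> Z T c\<close>: on \<open>[0,T]\<close> the curve \<open>c\<close> is a trajectory of the hybrid flow. Right
  after any time \<open>t\<close> it follows \<open>\<phi>\<close>, starting at \<open>c t\<close>, or at \<open>\<Delta> (c t)\<close> if \<open>c t \<in> S\<close>, and stays off
  \<open>S\<close> for a while; it is continuous from the left, so that at an impact time it takes the value
  before the reset. Impacts may accumulate at a time \<open>t\<close> (from the left) only if the limit \<open>c t\<close>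
  belongs to \<open>Z\<close>. Hence \<open>Z = {}\<close> yields the hybrid flow without continuation beyond Zeno times, and
  \<open>Z = junction S \<Delta>\<close> the completed one.\<close>

definition hybrid_arc ::
  "'a::t2_space set \<Rightarrow> (real \<Rightarrow> 'a \<Rightarrow> 'a) \<Rightarrow> ('a \<Rightarrow> 'a) \<Rightarrow> 'a set \<Rightarrow> real \<Rightarrow> (real \<Rightarrow> 'a) \<Rightarrow> bool" where
  "hybrid_arc S \<phi> \<Delta> Z T c \<longleftrightarrow>
     (\<forall>t. 0 \<le> t \<and> t < T \<longrightarrow>
        (\<exists>\<epsilon>>0. \<forall>\<delta>. 0 < \<delta> \<and> \<delta> < \<epsilon> \<longrightarrow>
           c (t + \<delta>) = \<phi> \<delta> (if c t \<in> S then \<Delta> (c t) else c t) \<and> c (t + \<delta>) \<notin> S)) \<and>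
     (\<forall>t. 0 < t \<and> t \<le> T \<longrightarrow>
        (c \<longlongrightarrow> c t) (at_left t) \<and>
        ((\<exists>\<epsilon>>0. \<forall>s. t - \<epsilon> < s \<and> s < t \<longrightarrow> c s \<notin> S) \<or> c t \<in> Z))"

definition hflow_dom ::
  "'a::t2_space set \<Rightarrow> (real \<Rightarrow> 'a \<Rightarrow> 'a) \<Rightarrow> ('a \<Rightarrow> 'a) \<Rightarrow> 'a set \<Rightarrow> real \<Rightarrow> 'a set" where
  "hflow_dom S \<phi> \<Delta> Z t = {x. \<exists>c. hybrid_arc S \<phi> \<Delta> Z t c \<and> c 0 = x}"

definition hflow ::
  "'a::t2_space set \<Rightarrow> (real \<Rightarrow> 'a \<Rightarrow> 'a) \<Rightarrow> ('a \<Rightarrow> 'a) \<Rightarrow> 'a set \<Rightarrow> real \<Rightarrow> 'a \<Rightarrow> 'a" where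
  "hflow S \<phi> \<Delta> Z t x = (THE y. \<exists>c. hybrid_arc S \<phi> \<Delta> Z t c \<and> c 0 = x \<and> c t = y)"

definition smooth_hybrid_system ::
  "('a::{t2_space, second_countable_topology}, 'b::euclidean_space) chart set
     \<Rightarrow> 'a set \<Rightarrow> (('a, 'b) chart \<Rightarrow> 'a \<Rightarrow> 'b) \<Rightarrow> ('a \<Rightarrow> 'a) \<Rightarrow> (real \<Rightarrow> 'a \<Rightarrow> 'a) \<Rightarrow> bool" where
  "smooth_hybrid_system A S X \<Delta> \<phi> \<longleftrightarrow>
     hybrid_system A S X \<Delta> \<and>
     (\<forall>t\<ge>0. \<forall>x\<in>hflow_dom S \<phi> \<Delta> {} t. hflow S \<phi> \<Delta> {} t x \<in> closure S - S \<longrightarrow>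
        (\<exists>\<epsilon>>0. \<forall>\<delta>. 0 < \<delta> \<and> \<delta> < \<epsilon> \<longrightarrow>
           x \<in> hflow_dom S \<phi> \<Delta> {} (t + \<delta>) \<and> hflow S \<phi> \<Delta> {} (t + \<delta>) x \<notin> S)) \<and>
     transversal A S X"

definition boundary_identity :: "'a::topological_space set \<Rightarrow> ('a \<Rightarrow> 'a) \<Rightarrow> bool" where
  "boundary_identity S \<Delta> \<longleftrightarrow>
     (\<forall>s z. (\<forall>n::nat. s n \<in> S) \<and> s \<longlonglongrightarrow> z \<and> z \<in> junction S \<Delta> \<longrightarrow> (\<lambda>n. \<Delta> (s n)) \<longlonglongrightarrow> z)"

abbreviation completed_dom ::
  "'a::t2_space set \<Rightarrow> (real \<Rightarrow> 'a \<Rightarrow> 'a) \<Rightarrow> ('a \<Rightarrow> 'a) \<Rightarrow> real \<Rightarrow> 'a set" where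
  "completed_dom S \<phi> \<Delta> t \<equiv> hflow_dom S \<phi> \<Delta> (junction S \<Delta>) t"

abbreviation completed_flow ::
  "'a::t2_space set \<Rightarrow> (real \<Rightarrow> 'a \<Rightarrow> 'a) \<Rightarrow> ('a \<Rightarrow> 'a) \<Rightarrow> real \<Rightarrow> 'a \<Rightarrow> 'a" where
  "completed_flow S \<phi> \<Delta> t x \<equiv> hflow S \<phi> \<Delta> (junction S \<Delta>) t x"

definition junction_reaching ::
  "'a::t2_space set \<Rightarrow> (real \<Rightarrow> 'a \<Rightarrow> 'a) \<Rightarrow> ('a \<Rightarrow> 'a) \<Rightarrow> 'a set" where
  "junction_reaching S \<phi> \<Delta> =
     {x. \<exists>t>0. (\<forall>s. 0 \<le> s \<and> s < t \<longrightarrow> x \<in> completed_dom S \<phi> \<Delta> s) \<and>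
            (\<exists>z\<in>junction S \<Delta>. ((\<lambda>s. completed_flow S \<phi> \<Delta> s x) \<longlongrightarrow> z) (at_left t))}"


section \<open>Invariant smooth measures\<close>

definition smooth_measure ::
  "('a::{t2_space, second_countable_topology}, 'b::euclidean_space) chart set
     \<Rightarrow> 'a measure \<Rightarrow> bool" where
  "smooth_measure A \<mu> \<longleftrightarrow> sets \<mu> = sets borel \<and>
     (\<forall>c\<in>A. \<exists>\<rho>::'b \<Rightarrow> real. smooth_on (coord c ` chart_dom c) \<rho> \<and>
        (\<forall>y\<in>coord c ` chart_dom c. \<rho> y > 0) \<and>
        (\<forall>B\<in>sets borel. B \<subseteq> chart_dom c \<longrightarrow>
           emeasure \<mu> B = (\<integral>\<^sup>+y\<in>coord c ` B. ennreal (\<rho> y) \<partial>lborel)))"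

text \<open>The hybrid flow is partial and in general neither injective nor surjective, so there are two
  senses in which \<open>\<mu>\<close> can be invariant under it: as a measure (push-forward, \<open>\<mu> (\<phi>\<^sub>t\<^sup>-\<^sup>1 B) = \<mu> B\<close>)
  or as a volume density (pull-back). The pull-back of \<open>\<mu>\<close> assigns to \<open>B\<close> the \<open>\<mu>\<close>-measure of its
  image counted with multiplicity; by the area formula this is integration over \<open>B\<close> of the
  pulled-back density wherever the flow is smooth. Either sense is admitted. Preimages are only
  required to be measurable up to null sets.\<close>

definition hflow_measurable ::
  "'a::t2_space measure \<Rightarrow> 'a set \<Rightarrow> (real \<Rightarrow> 'a \<Rightarrow> 'a) \<Rightarrow> ('a \<Rightarrow> 'a) \<Rightarrow> bool" where
  "hflow_measurable \<mu> S \<phi> \<Delta> \<longleftrightarrow>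
     (\<forall>t\<ge>0. \<forall>B\<in>sets \<mu>.
        {x \<in> completed_dom S \<phi> \<Delta> t. completed_flow S \<phi> \<Delta> t x \<in> B} \<in> sets (completion \<mu>))"

definition push_forward_invariant ::
  "'a::t2_space measure \<Rightarrow> 'a set \<Rightarrow> (real \<Rightarrow> 'a \<Rightarrow> 'a) \<Rightarrow> ('a \<Rightarrow> 'a) \<Rightarrow> bool" where
  "push_forward_invariant \<mu> S \<phi> \<Delta> \<longleftrightarrow>
     (\<forall>t\<ge>0. \<forall>B\<in>sets \<mu>.
        emeasure (completion \<mu>) {x \<in> completed_dom S \<phi> \<Delta> t. completed_flow S \<phi> \<Delta> t x \<in> B}
          = emeasure \<mu> B)"

definition pull_back_invariant ::
  "'a::t2_space measure \<Rightarrow> 'a set \<Rightarrow> (real \<Rightarrow> 'a \<Rightarrow> 'a) \<Rightarrow> ('a \<Rightarrow> 'a) \<Rightarrow> bool" where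
  "pull_back_invariant \<mu> S \<phi> \<Delta> \<longleftrightarrow>
     (\<forall>t\<ge>0. \<forall>B\<in>sets \<mu>. B \<subseteq> completed_dom S \<phi> \<Delta> t \<longrightarrow>
        (\<integral>\<^sup>+y. emeasure (count_space UNIV) {x \<in> B. completed_flow S \<phi> \<Delta> t x = y} \<partial>completion \<mu>)
          = emeasure \<mu> B)"

definition preserves_measure ::
  "'a::t2_space measure \<Rightarrow> 'a set \<Rightarrow> (real \<Rightarrow> 'a \<Rightarrow> 'a) \<Rightarrow> ('a \<Rightarrow> 'a) \<Rightarrow> bool" where
  "preserves_measure \<mu> S \<phi> \<Delta> \<longleftrightarrow> hflow_measurable \<mu> S \<phi> \<Delta> \<and>
     (push_forward_invariant \<mu> S \<phi> \<Delta> \<or> pull_back_invariant \<mu> S \<phi> \<Delta>)"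

end

theory Submission
  imports Defs
begin

text \<open>The boundary identity property keeps the junction set \<open>Z\<close> away from \<open>S\<close>: a constant sequence at
  a point of \<open>S \<inter> Z\<close> would give a fixed point of the reset. So a trajectory arriving at \<open>z \<in> Z\<close> at
  time \<open>t\<close> continues, by (A.1), as \<open>\<phi>\<^sub>\<delta>(z)\<close> for small \<open>\<delta>\<close>, and \<open>\<delta>\<close> can be chosen with \<open>t + \<delta>\<close> rational.
  As \<open>Z\<close> has codimension at least 2, its flow-out under \<open>\<phi>\<close> has codimension at least 1 and is a null
  set, so the points reaching \<open>Z\<close> lie in countably many preimages of a null set under the completed
  flow, which are null by invariance in either sense.\<close>

section \<open>Trajectories of the hybrid flow\<close>

lemma hybrid_arc_right:
  assumes "hybrid_arc S \<phi> \<Delta> Z T c" "0 \<le> t" "t < T"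
  obtains \<epsilon> where "\<epsilon> > 0"
    "\<And>\<delta>. 0 < \<delta> \<Longrightarrow> \<delta> < \<epsilon> \<Longrightarrow>
       c (t + \<delta>) = \<phi> \<delta> (if c t \<in> S then \<Delta> (c t) else c t) \<and> c (t + \<delta>) \<notin> S"
  using assms unfolding hybrid_arc_def by blast

lemma hybrid_arc_left:
  assumes "hybrid_arc S \<phi> \<Delta> Z T c" "0 < t" "t \<le> T"
  shows "(c \<longlongrightarrow> c t) (at_left t)"
    "(\<exists>\<epsilon>>0. \<forall>s. t - \<epsilon> < s \<and> s < t \<longrightarrow> c s \<notin> S) \<or> c t \<in> Z"
  using assms unfolding hybrid_arc_def by blast+

section \<open>Restriction, uniqueness and gluing of trajectories\<close>

lemma hybrid_arc_restrict:
  "hybrid_arc S \<phi> \<Delta> Z T c \<Longrightarrow> T' \<le> T \<Longrightarrow> hybrid_arc S \<phi> \<Delta> Z T' c"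
  unfolding hybrid_arc_def by (meson order.strict_trans2 order_trans)

lemma hybrid_arc_mono:
  "hybrid_arc S \<phi> \<Delta> Z T c \<Longrightarrow> Z \<subseteq> Z' \<Longrightarrow> hybrid_arc S \<phi> \<Delta> Z' T c"
  unfolding hybrid_arc_def by blast

lemma hybrid_arc_cong:
  assumes c: "hybrid_arc S \<phi> \<Delta> Z T c" and eq: "\<And>t. 0 \<le> t \<Longrightarrow> t \<le> T \<Longrightarrow> d t = c t"
  shows "hybrid_arc S \<phi> \<Delta> Z T d"
  unfolding hybrid_arc_def
proof (intro conjI allI impI; elim conjE)
  fix t :: real assume t: "0 \<le> t" "t < T"
  obtain \<epsilon> where e: "\<epsilon> > 0" "\<And>\<delta>. 0 < \<delta> \<Longrightarrow> \<delta> < \<epsilon> \<Longrightarrow>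
       c (t + \<delta>) = \<phi> \<delta> (if c t \<in> S then \<Delta> (c t) else c t) \<and> c (t + \<delta>) \<notin> S"
    using hybrid_arc_right[OF c t] by blast
  show "\<exists>\<epsilon>>0. \<forall>\<delta>. 0 < \<delta> \<and> \<delta> < \<epsilon> \<longrightarrow>
      d (t + \<delta>) = \<phi> \<delta> (if d t \<in> S then \<Delta> (d t) else d t) \<and> d (t + \<delta>) \<notin> S"
  \<comment> \<open>Shrinking to \<open>T - t\<close> keeps \<open>t + \<delta>\<close> inside
    \<open>[0,T]\<close>, the only place where \<open>d\<close> and \<open>c\<close> are known to
    agree.\<close>
  proof (intro exI[of _ "min \<epsilon> (T - t)"] conjI allI impI)
    fix \<delta> assume \<delta>: "0 < \<delta> \<and> \<delta> < min \<epsilon> (T - t)"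
    then have d: "d (t + \<delta>) = c (t + \<delta>)" "d t = c t" using t by (simp_all add: eq)
    show "d (t + \<delta>) = \<phi> \<delta> (if d t \<in> S then \<Delta> (d t) else d t)" "d (t + \<delta>) \<notin> S"
      unfolding d using e(2)[of \<delta>] \<delta> min_less_iff_conj by blast+
  qed (use e t in simp)
next
  fix t :: real assume t: "0 < t" "t \<le> T"
  have ev: "eventually (\<lambda>s. c s = d s) (at_left t)"
    using t by (auto simp: eventually_at_left_field eq intro!: exI[of _ 0])
  show "(d \<longlongrightarrow> d t) (at_left t)"
    using Lim_transform_eventually[OF hybrid_arc_left(1)[OF c t] ev] t by (simp add: eq)
  show "(\<exists>\<epsilon>>0. \<forall>s. t - \<epsilon> < s \<and> s < t \<longrightarrow> d s \<notin> S) \<or> d t \<in> Z"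
    using hybrid_arc_left(2)[OF c t]
  proof (elim disjE exE conjE)
    fix \<epsilon> :: real assume "\<epsilon> > 0" "\<forall>s. t - \<epsilon> < s \<and> s < t \<longrightarrow> c s \<notin> S"
    then have "\<forall>s. t - min \<epsilon> t < s \<and> s < t \<longrightarrow> d s \<notin> S" "min \<epsilon> t > 0"
      using t by (auto simp: eq)
    then show ?thesis by blast
  qed (use t in \<open>simp add: eq\<close>)
qed

text \<open>Let \<open>m\<close> be the infimum of the times of disagreement. Left continuity gives
  \<open>c m = d m\<close>, and the rule for the motion right after \<open>m\<close> depends only on
  this value, so the arcs still agree beyond \<open>m\<close>. This is what gives the definite
  description in \<open>hflow\<close> a meaning.\<close>

lemma hybrid_arc_unique:
  assumes c: "hybrid_arc S \<phi> \<Delta> Z T c" and d: "hybrid_arc S \<phi> \<Delta> Z T d"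
    and eq0: "c 0 = d 0" and t: "0 \<le> t" "t \<le> T"
  shows "c t = d t"
proof (rule ccontr)
  assume neq: "c t \<noteq> d t"
  define B where "B = {s. 0 \<le> s \<and> s \<le> T \<and> c s \<noteq> d s}"
  define m where "m = Inf B"
  have tB: "t \<in> B" using neq t by (auto simp: B_def)
  have bdd: "bdd_below B" by (auto simp: B_def intro!: bdd_belowI[of _ 0])
  have m0: "0 \<le> m" unfolding m_def using tB by (intro cInf_greatest) (auto simp: B_def)
  have mt: "m \<le> t" unfolding m_def using tB bdd by (rule cInf_lower)
  have below: "c s = d s" if "0 \<le> s" "s < m" for s
  proof (rule ccontr)
    assume "c s \<noteq> d s"
    then have "s \<in> B" using that mt t by (auto simp: B_def)
    then have "m \<le> s" unfolding m_def using bdd by (rule cInf_lower)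
    then show False using that by simp
  qed
  have at_m: "c m = d m"
  \<comment> \<open>At \<open>m = 0\<close> there is no left limit to compare; equality there is the
    initial condition.\<close>
  proof (cases "m = 0")
    case False
    then have m: "0 < m" "m \<le> T" using m0 mt t by auto
    have "eventually (\<lambda>s. c s = d s) (at_left m)"
      using m below by (auto simp: eventually_at_left_field intro!: exI[of _ 0])
    then have "(d \<longlongrightarrow> c m) (at_left m)"
      using Lim_transform_eventually hybrid_arc_left(1)[OF c m] by blast
    then show ?thesis
      using hybrid_arc_left(1)[OF d m] tendsto_unique trivial_limit_at_left_real by blast
  qed (use eq0 in simp)
  have "m \<noteq> t" using at_m neq by auto
  then have mT: "m < T" using mt t by auto
  obtain e1 where e1: "e1 > 0" "\<And>\<delta>. 0 < \<delta> \<Longrightarrow> \<delta> < e1 \<Longrightarrow>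
       c (m + \<delta>) = \<phi> \<delta> (if c m \<in> S then \<Delta> (c m) else c m) \<and> c (m + \<delta>) \<notin> S"
    using hybrid_arc_right[OF c m0 mT] by blast
  obtain e2 where e2: "e2 > 0" "\<And>\<delta>. 0 < \<delta> \<Longrightarrow> \<delta> < e2 \<Longrightarrow>
       d (m + \<delta>) = \<phi> \<delta> (if d m \<in> S then \<Delta> (d m) else d m) \<and> d (m + \<delta>) \<notin> S"
    using hybrid_arc_right[OF d m0 mT] by blast
  have "m + min e1 e2 \<le> s" if "s \<in> B" for s
  proof (rule ccontr)
    assume "\<not> m + min e1 e2 \<le> s"
    moreover have "m \<le> s" unfolding m_def using that bdd by (rule cInf_lower)
    moreover have "s \<noteq> m" using that at_m by (auto simp: B_def)
    ultimately have "c (m + (s - m)) = d (m + (s - m))"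
      using e1(2)[of "s - m"] e2(2)[of "s - m"] at_m by auto
    then show False using that by (simp add: B_def)
  qed
  then have "m + min e1 e2 \<le> m" unfolding m_def using tB by (intro cInf_greatest) auto
  then show False using e1(1) e2(1) by linarith
qed

lemma hflow_eq:
  assumes "hybrid_arc S \<phi> \<Delta> Z T c" "0 \<le> T"
  shows "hflow S \<phi> \<Delta> Z T (c 0) = c T"
  unfolding hflow_def
proof (rule the_equality)
  show "\<exists>d. hybrid_arc S \<phi> \<Delta> Z T d \<and> d 0 = c 0 \<and> d T = c T" using assms by blast
next
  fix y assume "\<exists>d. hybrid_arc S \<phi> \<Delta> Z T d \<and> d 0 = c 0 \<and> d T = y"
  then show "y = c T" using hybrid_arc_unique assms by (metis order_refl)
qed

text \<open>A single witness arc on \<open>[0,T]\<close> restricts to every shorter interval, so by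
  uniqueness it computes \<open>hflow\<close> at all intermediate times at once.\<close>

lemma hybrid_arc_hflow:
  assumes "x \<in> hflow_dom S \<phi> \<Delta> Z T"
  shows "hybrid_arc S \<phi> \<Delta> Z T (\<lambda>s. hflow S \<phi> \<Delta> Z s x)"
proof -
  obtain c where c: "hybrid_arc S \<phi> \<Delta> Z T c" "c 0 = x"
    using assms unfolding hflow_dom_def by blast
  show ?thesis
    using c(1)
  proof (rule hybrid_arc_cong)
    fix t assume "0 \<le> t" "t \<le> T"
    then show "hflow S \<phi> \<Delta> Z t x = c t"
      using hflow_eq[OF hybrid_arc_restrict[OF c(1)], of t] c(2) by simp
  qed
qed

lemma hflow_zero: "hflow S \<phi> \<Delta> Z 0 x = x" "x \<in> hflow_dom S \<phi> \<Delta> Z 0"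
proof -
  \<comment> \<open>For \<open>T = 0\<close> both clauses of \<open>hybrid_arc\<close> are
    vacuous.\<close>
  have "hybrid_arc S \<phi> \<Delta> Z 0 (\<lambda>_. x)" by (auto simp: hybrid_arc_def)
  from hflow_eq[OF this] this show "hflow S \<phi> \<Delta> Z 0 x = x" "x \<in> hflow_dom S \<phi> \<Delta> Z 0"
    by (auto simp: hflow_dom_def)
qed

text \<open>Gluing at a possible Zeno time: \<open>c\<close> need only be an arc on each interval
  shorter than \<open>t\<close>. At \<open>t\<close> the glued curve takes the value
  \<open>d 0\<close>, which is the left limit of \<open>c\<close>, and \<open>d 0 \<in> Z\<close> is
  what allows impacts to accumulate there.\<close>

lemma hybrid_arc_append:
  assumes c: "\<And>s. 0 \<le> s \<Longrightarrow> s < t \<Longrightarrow> hybrid_arc S \<phi> \<Delta> Z s c"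
    and t: "0 < t" and lim: "(c \<longlongrightarrow> d 0) (at_left t)" and Z: "d 0 \<in> Z"
    and d: "hybrid_arc S \<phi> \<Delta> Z u d"
  shows "hybrid_arc S \<phi> \<Delta> Z (t + u) (\<lambda>s. if s < t then c s else d (s - t))"
    (is "hybrid_arc _ _ _ _ _ ?g")
  unfolding hybrid_arc_def
proof (intro conjI allI impI; elim conjE)
  fix r :: real assume r: "0 \<le> r" "r < t + u"
  show "\<exists>\<epsilon>>0. \<forall>\<delta>. 0 < \<delta> \<and> \<delta> < \<epsilon> \<longrightarrow>
      ?g (r + \<delta>) = \<phi> \<delta> (if ?g r \<in> S then \<Delta> (?g r) else ?g r) \<and> ?g (r + \<delta>) \<notin> S"
  proof (cases "r < t")
    case True
    \<comment> \<open>The rule to the right of \<open>r\<close> needs an arc ending strictly after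
      \<open>r\<close>, while \<open>c\<close> is an arc only up to times before \<open>t\<close>;
      the midpoint satisfies both.\<close>
    have "hybrid_arc S \<phi> \<Delta> Z ((r + t) / 2) c" "r < (r + t) / 2" using c r True by auto
    note hybrid_arc_right[OF this(1) r(1) this(2)]
    then obtain \<epsilon> where e: "\<epsilon> > 0" "\<And>\<delta>. 0 < \<delta> \<Longrightarrow> \<delta> < \<epsilon> \<Longrightarrow>
        c (r + \<delta>) = \<phi> \<delta> (if c r \<in> S then \<Delta> (c r) else c r) \<and> c (r + \<delta>) \<notin> S"
      by blast
    show ?thesis
    proof (intro exI[of _ "min \<epsilon> (t - r)"] conjI allI impI)
      fix \<delta> assume \<delta>: "0 < \<delta> \<and> \<delta> < min \<epsilon> (t - r)"
      then have g: "?g (r + \<delta>) = c (r + \<delta>)" "?g r = c r" by auto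
      show "?g (r + \<delta>) = \<phi> \<delta> (if ?g r \<in> S then \<Delta> (?g r) else ?g r)" "?g (r + \<delta>) \<notin> S"
        unfolding g using e(2)[of \<delta>] \<delta> min_less_iff_conj by blast+
    qed (use e True in simp)
  next
    case False
    then have "0 \<le> r - t" "r - t < u" using r by auto
    note hybrid_arc_right[OF d this]
    then obtain \<epsilon> where e: "\<epsilon> > 0" "\<And>\<delta>. 0 < \<delta> \<Longrightarrow> \<delta> < \<epsilon> \<Longrightarrow>
        d (r - t + \<delta>) = \<phi> \<delta> (if d (r - t) \<in> S then \<Delta> (d (r - t)) else d (r - t)) \<and>
        d (r - t + \<delta>) \<notin> S"
      by blast
    show ?thesis
    proof (intro exI[of _ \<epsilon>] conjI allI impI)
      fix \<delta> assume \<delta>: "0 < \<delta> \<and> \<delta> < \<epsilon>"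
      then have g: "?g (r + \<delta>) = d (r - t + \<delta>)" "?g r = d (r - t)"
        using False by (auto simp: algebra_simps)
      show "?g (r + \<delta>) = \<phi> \<delta> (if ?g r \<in> S then \<Delta> (?g r) else ?g r)" "?g (r + \<delta>) \<notin> S"
        unfolding g using e(2)[of \<delta>] \<delta> by blast+
    qed (use e in simp)
  qed
next
  fix r :: real assume r: "0 < r" "r \<le> t + u"
  have ev_c: "eventually (\<lambda>s. c s = ?g s) (at_left r)" if "r \<le> t"
    using that by (auto simp: eventually_at_left_field intro!: exI[of _ "r - 1"])
  consider "r < t" | "r = t" | "r > t" by linarith
  then have "(?g \<longlongrightarrow> ?g r) (at_left r) \<and>
    ((\<exists>\<epsilon>>0. \<forall>s. r - \<epsilon> < s \<and> s < r \<longrightarrow> ?g s \<notin> S) \<or> ?g r \<in> Z)"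
  proof cases
    case 1
    have "hybrid_arc S \<phi> \<Delta> Z r c" using c r 1 by simp
    from hybrid_arc_left[OF this r(1) order_refl]
    show ?thesis using 1 Lim_transform_eventually[OF _ ev_c] by auto
  next
    case 2
    then show ?thesis using Lim_transform_eventually[OF _ ev_c] lim Z by auto
  next
    case 3
    then have "0 < r - t" "r - t \<le> u" using r by auto
    note L = hybrid_arc_left[OF d this]
    have "((\<lambda>s. d (s - t)) \<longlongrightarrow> d (r - t)) (at_left r)"
    proof (rule filterlim_compose[OF L(1)])
      show "filterlim (\<lambda>s. s - t) (at_left (r - t)) (at_left r)"
        unfolding filterlim_at by (auto intro!: tendsto_intros simp: eventually_at_filter)
    qed
    moreover have "eventually (\<lambda>s. d (s - t) = ?g s) (at_left r)"
      using 3 by (auto simp: eventually_at_left_field intro!: exI[of _ t])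
    ultimately have "(?g \<longlongrightarrow> d (r - t)) (at_left r)" by (rule Lim_transform_eventually)
    moreover have "(\<exists>\<epsilon>>0. \<forall>s. r - \<epsilon> < s \<and> s < r \<longrightarrow> ?g s \<notin> S) \<or> d (r - t) \<in> Z"
      using L(2)
    proof (elim disjE exE conjE)
      fix \<epsilon> :: real assume "\<epsilon> > 0" "\<forall>s. r - t - \<epsilon> < s \<and> s < r - t \<longrightarrow> d s \<notin> S"
      then have "\<forall>s. r - min \<epsilon> (r - t) < s \<and> s < r \<longrightarrow> ?g s \<notin> S" "min \<epsilon> (r - t) > 0"
        using 3 by (auto simp: algebra_simps)
      then show ?thesis by blast
    qed simp
    ultimately show ?thesis using 3 by auto
  qed
  then show "(?g \<longlongrightarrow> ?g r) (at_left r)"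
    and "(\<exists>\<epsilon>>0. \<forall>s. r - \<epsilon> < s \<and> s < r \<longrightarrow> ?g s \<notin> S) \<or> ?g r \<in> Z" by blast+
qed

section \<open>Continuation past the junction set\<close>

lemma boundary_identity_imp_junction_disjoint:
  fixes S :: "'a::t2_space set"
  assumes "boundary_identity S \<Delta>" "S \<inter> \<Delta> ` S = {}"
  shows "S \<inter> junction S \<Delta> = {}"
proof (rule ccontr)
  assume "S \<inter> junction S \<Delta> \<noteq> {}"
  then obtain s where s: "s \<in> S" "s \<in> junction S \<Delta>" by blast
  then have "(\<lambda>n::nat. \<Delta> s) \<longlonglongrightarrow> s"
    using assms(1)[unfolded boundary_identity_def, rule_format, of "\<lambda>_. s" s] by simp
  then have "\<Delta> s = s" by (simp add: LIMSEQ_const_iff)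
  then show False using s assms(2) by force
qed

text \<open>The trajectory arriving at \<open>z\<close> is glued to the one that (A.1) provides from
  \<open>z\<close>; since \<open>z \<notin> S\<close>, the latter starts without a reset and first
  follows \<open>\<phi>\<close>.\<close>

lemma junction_reaching_continue:
  fixes A :: "('a::{t2_space, second_countable_topology}, 'b::euclidean_space) chart set"
  assumes sys: "smooth_hybrid_system A S X \<Delta> \<phi>" and bd: "boundary_identity S \<Delta>"
    and x: "x \<in> junction_reaching S \<phi> \<Delta>"
  obtains t z \<epsilon> where "z \<in> junction S \<Delta>" "t > 0" "\<epsilon> > 0"
    "\<And>\<delta>. 0 < \<delta> \<Longrightarrow> \<delta> < \<epsilon> \<Longrightarrow> x \<in> completed_dom S \<phi> \<Delta> (t + \<delta>)"
    "\<And>\<delta>. 0 < \<delta> \<Longrightarrow> \<delta> < \<epsilon> \<Longrightarrow> completed_flow S \<phi> \<Delta> (t + \<delta>) x = \<phi> \<delta> z"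
proof -
  let ?Z = "junction S \<Delta>"
  obtain t z where t: "t > 0" and dom: "\<And>s. 0 \<le> s \<Longrightarrow> s < t \<Longrightarrow> x \<in> completed_dom S \<phi> \<Delta> s"
    and z: "z \<in> ?Z" and lim: "((\<lambda>s. completed_flow S \<phi> \<Delta> s x) \<longlongrightarrow> z) (at_left t)"
    using x unfolding junction_reaching_def by blast
  have zS: "z \<notin> S" "z \<in> closure S - S"
    using boundary_identity_imp_junction_disjoint[OF bd] sys z
    unfolding smooth_hybrid_system_def hybrid_system_def by (auto simp: junction_def)
  \<comment> \<open>This is (A.1) at time 0 for the trajectory started at \<open>z\<close> itself,
    whose value there is \<open>z\<close>, a point of \<open>closure S - S\<close>.\<close>
  have "\<exists>\<epsilon>>0. \<forall>\<delta>. 0 < \<delta> \<and> \<delta> < \<epsilon> \<longrightarrow> z \<in> hflow_dom S \<phi> \<Delta> {} (0 + \<delta>) \<and>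
      hflow S \<phi> \<Delta> {} (0 + \<delta>) z \<notin> S"
    using sys hflow_zero[where S = S and Z = "{}" and x = z] zS(2) unfolding smooth_hybrid_system_def
    by (metis order_refl)
  then obtain \<epsilon>' where e': "\<epsilon>' > 0"
    "\<And>\<delta>. 0 < \<delta> \<Longrightarrow> \<delta> < \<epsilon>' \<Longrightarrow> z \<in> hflow_dom S \<phi> \<Delta> {} \<delta>"
    by auto
  define u where "u = \<epsilon>' / 2"
  have u: "u > 0" using e' by (simp add: u_def)
  obtain d where d0: "hybrid_arc S \<phi> \<Delta> {} u d" and dz: "d 0 = z"
    using e'(2)[of u] e'(1) u unfolding hflow_dom_def u_def by auto
  \<comment> \<open>Enlarging the set of admissible Zeno limits only weakens the definition, so an
    uncompleted arc is also an arc of the completed flow.\<close>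
  have d: "hybrid_arc S \<phi> \<Delta> ?Z u d" using hybrid_arc_mono[OF d0] by simp
  obtain \<epsilon> where e: "\<epsilon> > 0" "\<And>\<delta>. 0 < \<delta> \<Longrightarrow> \<delta> < \<epsilon> \<Longrightarrow> d \<delta> = \<phi> \<delta> z"
  proof (rule hybrid_arc_right[OF d order_refl u])
    fix \<epsilon> :: real
    assume "\<epsilon> > 0" and "\<And>\<delta>. 0 < \<delta> \<Longrightarrow> \<delta> < \<epsilon> \<Longrightarrow>
        d (0 + \<delta>) = \<phi> \<delta> (if d 0 \<in> S then \<Delta> (d 0) else d 0) \<and> d (0 + \<delta>) \<notin> S"
    then show thesis using dz zS(1) that[of \<epsilon>] by simp
  qed
  let ?g = "\<lambda>s. if s < t then completed_flow S \<phi> \<Delta> s x else d (s - t)"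
  have g: "hybrid_arc S \<phi> \<Delta> ?Z (t + u) ?g"
  proof (rule hybrid_arc_append[OF _ t _ _ d])
    show "hybrid_arc S \<phi> \<Delta> ?Z s (\<lambda>s. completed_flow S \<phi> \<Delta> s x)" if "0 \<le> s" "s < t" for s
      using dom[OF that] by (rule hybrid_arc_hflow)
  qed (use lim z in \<open>simp_all only: dz\<close>)
  have g0: "?g 0 = x" using t by (simp add: hflow_zero)
  have gr: "hybrid_arc S \<phi> \<Delta> ?Z (t + \<delta>) ?g" if "\<delta> < u" for \<delta>
    using hybrid_arc_restrict[OF g] that by simp
  show thesis
  proof (rule that[OF z t])
    \<comment> \<open>Below \<open>\<epsilon>\<close> the arc \<open>d\<close> coincides with the
      \<open>\<phi>\<close>-orbit of \<open>z\<close>; below \<open>u\<close> the time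
      \<open>t + \<delta>\<close> stays within the glued arc.\<close>
    show "min \<epsilon> u > 0" using e u by simp
    show "x \<in> completed_dom S \<phi> \<Delta> (t + \<delta>)" if "0 < \<delta>" "\<delta> < min \<epsilon> u" for \<delta>
      unfolding hflow_dom_def
      by (intro CollectI exI[of _ ?g] conjI gr g0) (use that in linarith)
    show "completed_flow S \<phi> \<Delta> (t + \<delta>) x = \<phi> \<delta> z" if "0 < \<delta>" "\<delta> < min \<epsilon> u" for \<delta>
    proof -
      have "completed_flow S \<phi> \<Delta> (t + \<delta>) (?g 0) = ?g (t + \<delta>)"
        using that t by (intro hflow_eq gr) linarith+
      also have "\<dots> = \<phi> \<delta> z" using that e(2)[of \<delta>] by simp
      finally show ?thesis unfolding g0 .
    qed
  qed
qed

section \<open>The flow-out of a submanifold of codimension two\<close>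

lemma C1_lipschitz_on_compact_convex:
  fixes f :: "'b::euclidean_space \<Rightarrow> 'c::euclidean_space"
  assumes f: "Ck_on 1 U f" and K: "compact K" "convex K" "K \<subseteq> U"
  obtains C where "C > 0" "\<And>x y. x \<in> K \<Longrightarrow> y \<in> K \<Longrightarrow> norm (f x - f y) \<le> C * norm (x - y)"
proof -
  let ?D = "\<lambda>x. frechet_derivative f (at x)"
  have f': "\<And>x. x \<in> U \<Longrightarrow> f differentiable (at x)" "\<And>v. continuous_on U (\<lambda>x. ?D x v)"
    using f by simp_all
  have der: "(f has_derivative ?D x) (at x)" if "x \<in> K" for x
    using f'(1)[OF subsetD[OF K(3) that]] by (simp only: frechet_derivative_works)
  \<comment> \<open>\<open>Ck_on\<close> gives continuity of the derivative for each fixed direction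
    \<open>v\<close>, so compactness yields a bound that still depends on \<open>v\<close>.\<close>
  have "\<exists>m. \<forall>x\<in>K. norm (?D x v) \<le> m" for v
  proof -
    have "continuous_on K (\<lambda>x. ?D x v)" using f'(2) K(3) by (rule continuous_on_subset)
    from compact_imp_bounded[OF compact_continuous_image[OF this K(1)]]
    show ?thesis unfolding bounded_iff by auto
  qed
  then obtain m where m: "\<And>v x. x \<in> K \<Longrightarrow> norm (?D x v) \<le> m v" by metis
  \<comment> \<open>Expanding a vector in the basis turns the finitely many bounds
    \<open>m b\<close> into a bound of the operator norm; the mean value inequality on the convex
    set \<open>K\<close> then applies. The summand 1 makes \<open>C\<close> positive.\<close>
  define C where "C = (\<Sum>b\<in>Basis. \<bar>m b\<bar>) + 1"
  have C: "C > 0" unfolding C_def by (intro add_nonneg_pos sum_nonneg) auto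
  have "onorm (?D x) \<le> C" if x: "x \<in> K" for x
  proof (rule onorm_le)
    fix v
    have lin: "linear (?D x)" using der[OF x] has_derivative_linear by blast
    have "?D x v = ?D x (\<Sum>b\<in>Basis. (v \<bullet> b) *\<^sub>R b)" by (simp add: euclidean_representation)
    also have "\<dots> = (\<Sum>b\<in>Basis. (v \<bullet> b) *\<^sub>R ?D x b)"
      by (simp add: linear_sum[OF lin] linear_scale[OF lin])
    finally have "norm (?D x v) \<le> (\<Sum>b\<in>Basis. norm ((v \<bullet> b) *\<^sub>R ?D x b))"
      by (simp only: norm_sum)
    also have "\<dots> \<le> (\<Sum>b\<in>Basis. norm v * \<bar>m b\<bar>)"
    proof (rule sum_mono)
      fix b :: 'b assume "b \<in> Basis"
      then have "\<bar>v \<bullet> b\<bar> * norm (?D x b) \<le> norm v * \<bar>m b\<bar>"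
        using m[OF x, of b] by (intro mult_mono Basis_le_norm) auto
      then show "norm ((v \<bullet> b) *\<^sub>R ?D x b) \<le> norm v * \<bar>m b\<bar>" by simp
    qed
    also have "\<dots> \<le> C * norm v" by (simp add: C_def sum_distrib_left algebra_simps)
    finally show "norm (?D x v) \<le> C * norm v" .
  qed
  then have "norm (f x - f y) \<le> C * norm (x - y)" if "x \<in> K" "y \<in> K" for x y
    using differentiable_bound[OF K(2) has_derivative_at_withinI[OF der]] that by blast
  with C show thesis by (rule that)
qed

lemma onorm_scaleR_left_le:
  fixes v :: "'b::real_normed_vector"
  assumes "norm v \<le> m"
  shows "onorm (\<lambda>t::real. t *\<^sub>R v) \<le> m"
proof (rule onorm_le)
  show "norm (t *\<^sub>R v) \<le> m * norm t" for t :: real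
    using mult_right_mono[OF assms, of "norm t"] by (simp add: mult.commute)
qed

text \<open>On a time interval of length at most \<open>1 / (2 C)\<close>, taking the maximum of the distance of two
  solutions replaces Gronwall's inequality.\<close>

lemma integral_curves_short_time_bound:
  fixes u w :: "real \<Rightarrow> 'b::euclidean_space"
  assumes u: "\<And>s. 0 \<le> s \<Longrightarrow> s \<le> \<delta> \<Longrightarrow> (u has_vector_derivative Y (u s)) (at s) \<and> u s \<in> K"
    and w: "\<And>s. 0 \<le> s \<Longrightarrow> s \<le> \<delta> \<Longrightarrow> (w has_vector_derivative Y (w s)) (at s) \<and> w s \<in> K"
    and C: "C > 0" "\<And>x y. x \<in> K \<Longrightarrow> y \<in> K \<Longrightarrow> norm (Y x - Y y) \<le> C * norm (x - y)"
    and \<delta>: "0 \<le> \<delta>" "\<delta> * C \<le> 1 / 2"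
  shows "norm (u \<delta> - w \<delta>) \<le> 2 * norm (u 0 - w 0)"
proof -
  let ?h = "\<lambda>s. u s - w s"
  have der: "(?h has_vector_derivative (Y (u s) - Y (w s))) (at s)" if "s \<in> {0..\<delta>}" for s
    using u[of s] w[of s] that by (auto intro!: derivative_intros)
  have "continuous_on {0..\<delta>} (\<lambda>s. norm (?h s))"
    by (intro continuous_on_norm continuous_at_imp_continuous_on ballI
        has_vector_derivative_continuous[OF der])
  then obtain m where m: "m \<in> {0..\<delta>}" "\<And>s. s \<in> {0..\<delta>} \<Longrightarrow> norm (?h s) \<le> norm (?h m)"
    using continuous_attains_sup[of "{0..\<delta>}" "\<lambda>s. norm (?h s)"] \<delta>(1) by auto
  \<comment> \<open>By maximality of \<open>m\<close> the derivative of \<open>?h\<close> is at most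
    \<open>C * norm (?h m)\<close> throughout. As \<open>C * m \<le> 1 / 2\<close>, half of
    \<open>norm (?h m)\<close> is absorbed on the left, which produces the factor 2.\<close>
  have "norm (?h m - ?h 0) \<le> C * norm (?h m) * norm (m - 0)"
  proof (rule differentiable_bound[where S = "{0..\<delta>}" and
        f' = "\<lambda>s t. t *\<^sub>R (Y (u s) - Y (w s))"])
    fix s assume s: "s \<in> {0..\<delta>}"
    show "(?h has_derivative (\<lambda>t. t *\<^sub>R (Y (u s) - Y (w s)))) (at s within {0..\<delta>})"
      using der[OF s] has_derivative_at_withinI unfolding has_vector_derivative_def by blast
    have "norm (Y (u s) - Y (w s)) \<le> C * norm (?h s)" using C(2) u[of s] w[of s] s by auto
    also have "\<dots> \<le> C * norm (?h m)" using C(1) m(2)[OF s] by simp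
    finally show "onorm (\<lambda>t. t *\<^sub>R (Y (u s) - Y (w s))) \<le> C * norm (?h m)"
      by (rule onorm_scaleR_left_le)
  qed (use m \<delta> in auto)
  also have "\<dots> = (C * m) * norm (?h m)" using m by simp
  also have "\<dots> \<le> (1 / 2) * norm (?h m)"
  proof (rule mult_right_mono)
    have "C * m \<le> C * \<delta>" using m C(1) by simp
    then show "C * m \<le> 1 / 2" using \<delta>(2) by (simp add: mult.commute)
  qed simp
  finally have "norm (?h m) \<le> 2 * norm (?h 0)"
    using norm_triangle_ineq2[of "?h m" "?h 0"] by simp
  then show ?thesis using m(2)[of \<delta>] \<delta>(1) by simp
qed

text \<open>The time is encoded as the coordinate along a unit vector \<open>e\<close> orthogonal to \<open>L\<close>: then the
  flow-out is a Lipschitz image of a subset of a proper subspace.\<close>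

lemma negligible_lipschitz_flow_out:
  fixes g :: "real \<Rightarrow> 'b::euclidean_space \<Rightarrow> 'b"
  assumes L: "affine L" "aff_dim L = int k" "k + 2 \<le> DIM('b)"
    and D: "\<And>\<delta> v. (\<delta>, v) \<in> D \<Longrightarrow> v \<in> L"
    and lip: "\<And>\<delta> v \<delta>' v'. (\<delta>, v) \<in> D \<Longrightarrow> (\<delta>', v') \<in> D \<Longrightarrow>
        norm (g \<delta> v - g \<delta>' v') \<le> C * (\<bar>\<delta> - \<delta>'\<bar> + norm (v - v'))"
    and C: "0 \<le> C"
  shows "negligible ((\<lambda>(\<delta>, v). g \<delta> v) ` D)"
proof (cases "L = {}")
  case True
  then have "D = {}" using D by auto
  then show ?thesis by simp
next
  case False
  then obtain a where a: "a \<in> L" by auto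
  \<comment> \<open>The direction space of \<open>L\<close>, of dimension \<open>k\<close>.\<close>
  define L0 where "L0 = (+) (- a) ` L"
  have "int (dim L0) = int k"
    using aff_dim_eq_dim[of a L] a L(2) hull_inc[of a L affine] by (simp add: L0_def)
  then have dimL0: "dim L0 + 2 \<le> DIM('b)" using L(3) by simp
  then obtain x where x: "x \<noteq> 0" "\<And>y. y \<in> span L0 \<Longrightarrow> orthogonal x y"
    using orthogonal_to_subspace_exists[of L0] by (metis add_2_eq_Suc' Suc_le_eq Suc_lessD)
  define e where "e = x /\<^sub>R norm x"
  have e1: "norm e = 1" "e \<bullet> e = 1" using x(1) by (auto simp: e_def dot_square_norm)
  have e0: "e \<bullet> (v - a) = 0" if "v \<in> L" for v
    using x(2)[of "- a + v"] that by (auto simp: e_def orthogonal_def L0_def span_base)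
  \<comment> \<open>\<open>S\<close> encodes the pairs in \<open>D\<close>; \<open>p\<close> reads
    off the time and \<open>q\<close> the point of \<open>L\<close>, so \<open>h\<close> on
    \<open>S\<close> is \<open>g\<close> after decoding.\<close>
  define S where "S = (\<lambda>(\<delta>, v). (v - a) + \<delta> *\<^sub>R e) ` D"
  define p where "p = (\<lambda>y. e \<bullet> y)"
  define q where "q = (\<lambda>y. a + y - (e \<bullet> y) *\<^sub>R e)"
  define h where "h = (\<lambda>y. g (p y) (q y))"
  have pq: "p ((v - a) + \<delta> *\<^sub>R e) = \<delta>" "q ((v - a) + \<delta> *\<^sub>R e) = v" if "(\<delta>, v) \<in> D" for \<delta> v
    using e0[OF D[OF that]] e1 by (simp_all add: p_def q_def inner_add_right)
  have "S \<subseteq> span (insert e L0)"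
  proof
    fix y assume "y \<in> S"
    then obtain \<delta> v where "(\<delta>, v) \<in> D" "y = (v - a) + \<delta> *\<^sub>R e" by (auto simp: S_def)
    moreover from this have "v - a \<in> L0" using D by (auto simp: L0_def image_iff)
    ultimately show "y \<in> span (insert e L0)"
      by (auto intro!: span_add span_scale intro: span_base)
  qed
  \<comment> \<open>One dimension is spent on time. Codimension 2 of \<open>L\<close> leaves
    codimension at least 1 for \<open>S\<close>.\<close>
  then have "dim S \<le> dim (insert e L0)" by (metis dim_span dim_subset)
  also have "\<dots> \<le> dim L0 + 1" by (simp add: dim_insert)
  also have "\<dots> < DIM('b)" using dimL0 by simp
  finally have negS: "negligible S" by (rule negligible_lowdim)
  have "negligible (h ` S)"
  proof (rule negligible_locally_Lipschitz_image[OF order_refl negS])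
    fix y assume y: "y \<in> S"
    \<comment> \<open>The constant 3 arises because \<open>p\<close> is 1-Lipschitz and
      \<open>q\<close> is 2-Lipschitz.\<close>
    have "norm (h y' - h y) \<le> 3 * C * norm (y' - y)" if y': "y' \<in> S" for y'
    proof -
      have D': "(p z, q z) \<in> D" if "z \<in> S" for z using that pq by (auto simp: S_def)
      have "\<bar>p y' - p y\<bar> \<le> norm (y' - y)"
        using Cauchy_Schwarz_ineq2[of e "y' - y"] e1 by (simp add: p_def inner_diff_right)
      moreover have "norm (q y' - q y) \<le> norm (y' - y) + \<bar>p y' - p y\<bar>"
      proof -
        have "q y' - q y = (y' - y) - (p y' - p y) *\<^sub>R e"
          by (simp add: q_def p_def algebra_simps)
        then show ?thesis using norm_triangle_ineq4[of "y' - y" "(p y' - p y) *\<^sub>R e"] e1 by simp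
      qed
      ultimately have "\<bar>p y' - p y\<bar> + norm (q y' - q y) \<le> 3 * norm (y' - y)" by simp
      then have "C * (\<bar>p y' - p y\<bar> + norm (q y' - q y)) \<le> C * (3 * norm (y' - y))"
        using C mult_left_mono by blast
      then show ?thesis using lip[OF D'[OF y'] D'[OF y]] by (simp add: h_def)
    qed
    then show "\<exists>T B. open T \<and> y \<in> T \<and> (\<forall>y'\<in>S \<inter> T. norm (h y' - h y) \<le> B * norm (y' - y))"
      by (intro exI[of _ UNIV]) auto
  qed
  moreover have "(\<lambda>(\<delta>, v). g \<delta> v) ` D = h ` S"
    unfolding S_def image_image by (intro image_cong) (auto simp: h_def pq)
  ultimately show ?thesis by simp
qed

section \<open>Null sets of a smooth measure and the flow-out on the manifold\<close>

lemma negligible_chart_preimage_null: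
  fixes A :: "('a::{t2_space, second_countable_topology}, 'b::euclidean_space) chart set"
  assumes c: "c \<in> A" "is_chart c" and \<mu>: "smooth_measure A \<mu>" and E: "negligible E"
  obtains W where "W \<in> null_sets \<mu>" "{x \<in> chart_dom c. coord c x \<in> E} \<subseteq> W"
proof -
  \<comment> \<open>A negligible set need not be Borel, but the density formula of
    \<open>smooth_measure\<close> speaks of Borel sets only; hence the Borel null hull
    \<open>E'\<close>.\<close>
  obtain E' where E': "E' \<in> null_sets lborel" "E \<subseteq> E'"
    using E unfolding negligible_iff_null_sets null_sets_completion_iff2 by blast
  then have [measurable]: "E' \<in> sets borel" by auto
  let ?W = "{x \<in> chart_dom c. coord c x \<in> E'}"
  have dom: "open (chart_dom c)" "continuous_on (chart_dom c) (coord c)"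
    using c(2) by (auto simp: is_chart_def homeomorphism_def)
  then have "coord c \<in> borel_measurable (restrict_space borel (chart_dom c))"
    by (intro borel_measurable_continuous_on_restrict)
  then have "coord c -` E' \<inter> space (restrict_space borel (chart_dom c)) 
      \<in> sets (restrict_space borel (chart_dom c))"
    by (rule measurable_sets) simp
  then have W: "?W \<in> sets borel"
    using dom(1) by (simp add: sets_restrict_space_iff space_restrict_space
        vimage_def Int_def conj_commute)
  obtain \<rho> :: "'b \<Rightarrow> real" where \<rho>: "\<And>B. B \<in> sets borel \<Longrightarrow> B \<subseteq> chart_dom c \<Longrightarrow>
      emeasure \<mu> B = (\<integral>\<^sup>+y\<in>coord c ` B. ennreal (\<rho> y) \<partial>lborel)"
    using \<mu> c(1) unfolding smooth_measure_def by meson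
  have "emeasure \<mu> ?W = (\<integral>\<^sup>+y\<in>coord c ` ?W. ennreal (\<rho> y) \<partial>lborel)"
    using \<rho>[OF W] by auto
  also have "\<dots> = (\<integral>\<^sup>+y. 0 \<partial>(lborel :: 'b measure))"
    \<comment> \<open>The domain of integration lies in the null set \<open>E'\<close>, so the
      integrand vanishes almost everywhere.\<close>
    by (intro nn_integral_cong_AE eventually_mono[OF AE_not_in[OF E'(1)]]) (auto simp: indicator_def)
  finally have "?W \<in> null_sets \<mu>"
    using W \<mu> by (auto simp: null_sets_def smooth_measure_def)
  then show thesis using E'(2) by (intro that[of ?W]) auto
qed

text \<open>In a slice chart at \<open>p\<close> the submanifold is a piece of an affine subspace.
  Orbits that start on it and remain in a coordinate ball depend in a Lipschitz way on time and
  starting point, so together they sweep out a null set. One \<open>W\<close> serves all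
  \<open>z\<close> in \<open>N \<inter> V\<close>, whereas \<open>\<epsilon>\<close> depends on
  \<open>z\<close>.\<close>

lemma local_flow_out_null:
  fixes A :: "('a::{t2_space, second_countable_topology}, 'b::euclidean_space) chart set"
  assumes A: "smooth_structure A" and X: "smooth_vector_field A X" and \<phi>: "is_flow A X \<phi>"
    and \<mu>: "smooth_measure A \<mu>"
    and N: "embedded_submanifold A k N" "k + 2 \<le> DIM('b)" and p: "p \<in> N"
  obtains V W where "open V" "p \<in> V" "W \<in> null_sets \<mu>"
    "\<And>z. z \<in> N \<inter> V \<Longrightarrow> \<exists>\<epsilon>>0. \<forall>\<delta>. 0 < \<delta> \<and> \<delta> < \<epsilon> \<longrightarrow> \<phi> \<delta> z \<in> W"
proof -
  obtain c L where c: "c \<in> A" "p \<in> chart_dom c" and L: "affine L" "aff_dim L = int k"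
    and slice: "coord c ` (chart_dom c \<inter> N) = coord c ` chart_dom c \<inter> L"
    using N(1) p unfolding embedded_submanifold_def by metis
  have chart: "is_chart c" using A c(1) unfolding smooth_structure_def by blast
  then have dom: "open (chart_dom c)" "open (coord c ` chart_dom c)"
      "continuous_on (chart_dom c) (coord c)"
    and inv: "\<And>x. x \<in> chart_dom c \<Longrightarrow> chart_inv c (coord c x) = x"
    by (auto simp: is_chart_def homeomorphism_def)
  define Y where "Y = X c \<circ> chart_inv c"
  have Y: "Ck_on 1 (coord c ` chart_dom c) Y"
    using X c(1) unfolding smooth_vector_field_def smooth_on_def Y_def by blast
  obtain r where r: "r > 0" "cball (coord c p) r \<subseteq> coord c ` chart_dom c"
    using dom(2) c(2) open_contains_cball by (metis imageI)
  let ?K = "cball (coord c p) r"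
  obtain C where C: "C > 0" "\<And>x y. x \<in> ?K \<Longrightarrow> y \<in> ?K \<Longrightarrow> norm (Y x - Y y) \<le> C * norm (x - y)"
    using C1_lipschitz_on_compact_convex[OF Y compact_cball convex_cball r(2)] by blast
  \<comment> \<open>\<open>M\<close> bounds the field on the ball, hence the speed of the orbits
    inside it.\<close>
  define M where "M = norm (Y (coord c p)) + C * r"
  have M: "norm (Y x) \<le> M" if "x \<in> ?K" for x
  proof -
    have "norm (Y x - Y (coord c p)) \<le> C * norm (x - coord c p)" using C(2) that r(1) by simp
    also have "\<dots> \<le> C * r" using that C(1) by (simp add: dist_norm norm_minus_commute)
    finally show ?thesis using norm_triangle_ineq2[of "Y x" "Y (coord c p)"] by (simp add: M_def)
  qed
  have M0: "0 \<le> M" using C(1) r(1) by (simp add: M_def)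
  define V where "V = {x \<in> chart_dom c. coord c x \<in> ball (coord c p) r}"
  have "open V"
    using continuous_open_preimage[OF dom(3,1) open_ball] by (simp add: V_def vimage_def Int_def)
  have pV: "p \<in> V" using c(2) r(1) by (simp add: V_def)
  have VK: "coord c x \<in> ?K" if "x \<in> V" for x using that by (simp add: V_def less_imp_le)
  \<comment> \<open>The whole orbit segment, not just its endpoint, must lie in \<open>V\<close> for
    the Lipschitz bounds on the ball to apply.\<close>
  define stay where "stay = (\<lambda>\<delta> z. \<forall>s. 0 \<le> s \<and> s \<le> \<delta> \<longrightarrow> \<phi> s z \<in> V)"
  define u where "u = (\<lambda>z s. coord c (\<phi> s z))"
  have u: "(u z has_vector_derivative Y (u z s)) (at s) \<and> u z s \<in> ?K"
    if "stay \<delta> z" "0 \<le> s" "s \<le> \<delta>" for \<delta> z s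
  proof -
    have V: "\<phi> s z \<in> V" using that by (simp add: stay_def)
    then have "\<phi> s z \<in> chart_dom c" by (simp add: V_def)
    then have "((coord c \<circ> (\<lambda>t. \<phi> t z)) has_vector_derivative X c (\<phi> s z)) (at s)"
      using \<phi> c(1) unfolding is_flow_def integral_curve_def by blast
    then show ?thesis
      using VK[OF V] inv \<open>\<phi> s z \<in> chart_dom c\<close> by (simp add: u_def Y_def o_def)
  qed
  have u0: "u z 0 = coord c z" for z using \<phi> by (simp add: u_def is_flow_def)
  have bound_space: "norm (u z \<delta> - u z' \<delta>) \<le> 2 * norm (coord c z - coord c z')"
    if "stay \<delta> z" "stay \<delta> z'" "0 \<le> \<delta>" "\<delta> * C \<le> 1 / 2" for z z' \<delta>
    using integral_curves_short_time_bound[of \<delta> "u z" Y ?K "u z'" C] u that C u0 by metis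
  have bound_time: "norm (u z \<delta>' - u z \<delta>) \<le> M * \<bar>\<delta>' - \<delta>\<bar>"
    if "stay \<delta>' z" "0 \<le> \<delta>" "\<delta> \<le> \<delta>'" for z \<delta> \<delta>'
  proof -
    have "norm (u z \<delta>' - u z \<delta>) \<le> M * norm (\<delta>' - \<delta>)"
    proof (rule differentiable_bound[where S = "{0..\<delta>'}" and f' = "\<lambda>s t. t *\<^sub>R Y (u z s)"])
      fix s assume "s \<in> {0..\<delta>'}"
      then have "(u z has_vector_derivative Y (u z s)) (at s)" "u z s \<in> ?K"
        using u[OF that(1), of s] by auto
      note this(1) and Ms = M[OF this(2)]
      then show "(u z has_derivative (\<lambda>t. t *\<^sub>R Y (u z s))) (at s within {0..\<delta>'})"
        using has_derivative_at_withinI unfolding has_vector_derivative_def by blast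
      show "onorm (\<lambda>t. t *\<^sub>R Y (u z s)) \<le> M"
        using Ms by (rule onorm_scaleR_left_le)
    qed (use that in auto)
    then show ?thesis by simp
  qed
  define D where "D = {(\<delta>, coord c z) |\<delta> z. z \<in> N \<inter> V \<and> 0 \<le> \<delta> \<and> \<delta> * C \<le> 1 / 2 \<and> stay \<delta> z}"
  define g where "g = (\<lambda>\<delta> v. u (chart_inv c v) \<delta>)"
  have g: "g \<delta> (coord c z) = u z \<delta>" if "z \<in> V" for \<delta> z
    using that inv by (simp add: g_def V_def)
  \<comment> \<open>For \<open>\<delta> \<le> \<delta>'\<close> the comparison passes through
    \<open>u z' \<delta>\<close>: both orbits at the common time \<open>\<delta>\<close>, with
    factor 2, then the orbit of \<open>z'\<close> from \<open>\<delta>\<close> to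
    \<open>\<delta>'\<close>, with speed at most \<open>M\<close>. The constant \<open>M + 2\<close>
    covers both.\<close>
  have half: "norm (u z \<delta> - u z' \<delta>') \<le> (M + 2) * (\<bar>\<delta> - \<delta>'\<bar> + norm (coord c z - coord c z'))"
    if "stay \<delta> z" "stay \<delta>' z'" "0 \<le> \<delta>" "\<delta> \<le> \<delta>'" "\<delta>' * C \<le> 1 / 2" for z z' \<delta> \<delta>'
  proof -
    define d where "d = \<bar>\<delta> - \<delta>'\<bar>"
    have "stay \<delta> z'" using that by (auto simp: stay_def)
    moreover have "\<delta> * C \<le> 1 / 2" using that(4,5) C(1) mult_right_mono[of \<delta> \<delta>' C] by linarith
    ultimately have "norm (u z \<delta> - u z' \<delta>) \<le> 2 * norm (coord c z - coord c z')"
      using bound_space that by blast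
    moreover have "norm (u z' \<delta> - u z' \<delta>') \<le> M * \<bar>\<delta> - \<delta>'\<bar>"
      using bound_time[OF that(2-4)] by (simp add: norm_minus_commute abs_minus_commute)
    moreover have "norm (u z \<delta> - u z' \<delta>') \<le> norm (u z \<delta> - u z' \<delta>) + norm (u z' \<delta> - u z' \<delta>')"
      using norm_triangle_ineq[of "u z \<delta> - u z' \<delta>" "u z' \<delta> - u z' \<delta>'"] by simp
    moreover have "0 \<le> M * norm (coord c z - coord c z')" "0 \<le> \<bar>\<delta> - \<delta>'\<bar>" using M0 by simp_all
    ultimately have "norm (u z \<delta> - u z' \<delta>') \<le> M * \<bar>\<delta> - \<delta>'\<bar> + 2 * \<bar>\<delta> - \<delta>'\<bar> +
        (M * norm (coord c z - coord c z') + 2 * norm (coord c z - coord c z'))"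
      unfolding d_def[symmetric] by linarith
    then show ?thesis by (simp add: algebra_simps)
  qed
  have "negligible ((\<lambda>(\<delta>, v). g \<delta> v) ` D)"
  proof (rule negligible_lipschitz_flow_out[OF L N(2)])
    show "v \<in> L" if "(\<delta>, v) \<in> D" for \<delta> v
      using that slice unfolding D_def V_def by blast
    show "norm (g \<delta> v - g \<delta>' v') \<le> (M + 2) * (\<bar>\<delta> - \<delta>'\<bar> + norm (v - v'))"
      if d: "(\<delta>, v) \<in> D" "(\<delta>', v') \<in> D" for \<delta> v \<delta>' v'
    proof -
      obtain z z' where z: "v = coord c z" "z \<in> V" "0 \<le> \<delta>" "\<delta> * C \<le> 1 / 2" "stay \<delta> z"
        and z': "v' = coord c z'" "z' \<in> V" "0 \<le> \<delta>'" "\<delta>' * C \<le> 1 / 2" "stay \<delta>' z'"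
        using d unfolding D_def by auto
      show ?thesis
      proof (cases "\<delta> \<le> \<delta>'")
        case True
        then show ?thesis using half[of \<delta> z \<delta>' z'] z z' g by simp
      next
        case False
        then show ?thesis using half[of \<delta>' z' \<delta> z] z z' g
          by (simp add: norm_minus_commute abs_minus_commute)
      qed
    qed
  qed (use M0 in simp)
  then obtain W where W: "W \<in> null_sets \<mu>"
    "{x \<in> chart_dom c. coord c x \<in> (\<lambda>(\<delta>, v). g \<delta> v) ` D} \<subseteq> W"
    using negligible_chart_preimage_null[OF c(1) chart \<mu>] by blast
  show thesis
  proof (rule that[OF \<open>open V\<close> pV W(1)])
    fix z assume z: "z \<in> N \<inter> V"
    have "continuous_on UNIV (\<lambda>t. \<phi> t z)" "\<phi> 0 z = z"
      using \<phi> unfolding is_flow_def integral_curve_def by auto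
    then have "open {t. \<phi> t z \<in> V}" "0 \<in> {t. \<phi> t z \<in> V}"
      using open_vimage[OF \<open>open V\<close>, of "\<lambda>t. \<phi> t z"] z by (auto simp: vimage_def)
    then obtain e where e: "e > 0" "ball 0 e \<subseteq> {t. \<phi> t z \<in> V}"
      unfolding open_contains_ball by blast
    \<comment> \<open>Below \<open>e\<close> the orbit has not left \<open>V\<close>;
      \<open>1 / (2 * C)\<close> is the time limit built into \<open>D\<close>.\<close>
    have "\<phi> \<delta> z \<in> W" if d: "0 < \<delta>" "\<delta> < min e (1 / (2 * C))" for \<delta>
    proof -
      have "stay \<delta> z" unfolding stay_def using e(2) d by (auto simp: subset_iff)
      moreover have "\<delta> * C \<le> 1 / 2" using d C(1) by (simp add: field_simps)
      ultimately have "(\<delta>, coord c z) \<in> D" unfolding D_def using z d by force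
      then have "coord c (\<phi> \<delta> z) \<in> (\<lambda>(\<delta>, v). g \<delta> v) ` D"
        using g[of z \<delta>] z by (force simp: u_def image_iff)
      moreover have "\<phi> \<delta> z \<in> chart_dom c" using \<open>stay \<delta> z\<close> d by (auto simp: stay_def V_def)
      ultimately show ?thesis using W(2) by blast
    qed
    then show "\<exists>\<epsilon>>0. \<forall>\<delta>. 0 < \<delta> \<and> \<delta> < \<epsilon> \<longrightarrow> \<phi> \<delta> z \<in> W"
      using e(1) C(1) by (intro exI[of _ "min e (1 / (2 * C))"]) auto
  qed
qed

text \<open>The local null sets are combined by countable unions: a point of a union inherits its
  \<open>\<epsilon>\<close> from the piece containing it, and enlarging \<open>W\<close> does no
  harm.\<close>

lemma flow_out_null:
  fixes A :: "('a::{t2_space, second_countable_topology}, 'b::euclidean_space) chart set"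
  assumes A: "smooth_structure A" and X: "smooth_vector_field A X" and \<phi>: "is_flow A X \<phi>"
    and \<mu>: "smooth_measure A \<mu>" and Z: "codim_at_least_2 A Z"
  obtains W where "W \<in> null_sets \<mu>"
    "\<And>z. z \<in> Z \<Longrightarrow> \<exists>\<epsilon>>0. \<forall>\<delta>. 0 < \<delta> \<and> \<delta> < \<epsilon> \<longrightarrow> \<phi> \<delta> z \<in> W"
proof -
  let ?P = "\<lambda>B W. \<forall>z\<in>B. \<exists>\<epsilon>>0. \<forall>\<delta>. 0 < \<delta> \<and> \<delta> < \<epsilon> \<longrightarrow> \<phi> \<delta> z \<in> W"
  have union: "\<exists>W\<in>null_sets \<mu>. ?P (\<Union>\<B>) W"
    if \<B>: "countable \<B>" "\<And>B. B \<in> \<B> \<Longrightarrow> \<exists>W\<in>null_sets \<mu>. ?P B W" for \<B>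
  proof -
    obtain w where w: "\<And>B. B \<in> \<B> \<Longrightarrow> w B \<in> null_sets \<mu>" "\<And>B. B \<in> \<B> \<Longrightarrow> ?P B (w B)"
      using \<B>(2) by metis
    have "(\<Union>B\<in>\<B>. w B) \<in> null_sets \<mu>" using \<B>(1) w(1) by (intro null_sets_UN') auto
    moreover have "?P (\<Union>\<B>) (\<Union>B\<in>\<B>. w B)"
    proof
      fix z assume "z \<in> \<Union>\<B>"
      then obtain B where B: "B \<in> \<B>" "z \<in> B" by blast
      then obtain \<epsilon> where "\<epsilon> > 0" "\<forall>\<delta>. 0 < \<delta> \<and> \<delta> < \<epsilon> \<longrightarrow> \<phi> \<delta> z \<in> w B" using w(2) by meson
      then show "\<exists>\<epsilon>>0. \<forall>\<delta>. 0 < \<delta> \<and> \<delta> < \<epsilon> \<longrightarrow> \<phi> \<delta> z \<in> (\<Union>B\<in>\<B>. w B)"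
        using B(1) by (intro exI[of _ \<epsilon>]) auto
    qed
    ultimately show ?thesis by blast
  qed
  have sub: "\<exists>W\<in>null_sets \<mu>. ?P N W" if N: "embedded_submanifold A k N" "k + 2 \<le> DIM('b)" for k N
  proof -
    \<comment> \<open>The open sets on which the local claim holds cover \<open>N\<close>; second
      countability extracts a countable subcover. The union step is applied a second time to the
      countable family \<open>F\<close>.\<close>
    define \<V> where "\<V> = {V. open V \<and> (\<exists>W\<in>null_sets \<mu>. ?P (N \<inter> V) W)}"
    obtain \<V>' where V': "\<V>' \<subseteq> \<V>" "countable \<V>'" "\<Union>\<V>' = \<Union>\<V>"
      using Lindelof[of \<V>] by (auto simp: \<V>_def)
    have "N \<subseteq> \<Union>\<V>"
    proof
      fix p assume "p \<in> N"
      from local_flow_out_null[OF A X \<phi> \<mu> N this]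
      show "p \<in> \<Union>\<V>" unfolding \<V>_def by (smt (verit) UnionI mem_Collect_eq)
    qed
    then have "N = \<Union>((\<inter>) N ` \<V>')" using V'(3) by blast
    moreover have "\<exists>W\<in>null_sets \<mu>. ?P (\<Union>((\<inter>) N ` \<V>')) W"
      using V'(1,2) by (intro union) (auto simp: \<V>_def)
    ultimately show ?thesis by simp
  qed
  obtain F where F: "countable F" "Z \<subseteq> \<Union>F"
    "\<And>N. N \<in> F \<Longrightarrow> \<exists>k. k + 2 \<le> DIM('b) \<and> embedded_submanifold A k N"
    using Z unfolding codim_at_least_2_def by blast
  have "\<exists>W\<in>null_sets \<mu>. ?P (\<Union>F) W" using F(1,3) sub by (intro union) blast+
  then obtain W where W: "W \<in> null_sets \<mu>" "?P (\<Union>F) W" by (elim bexE)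
  show thesis
  proof (rule that[OF W(1)])
    fix z assume "z \<in> Z"
    then have "z \<in> \<Union>F" using F(2) by (rule subsetD[rotated])
    with W(2) show "\<exists>\<epsilon>>0. \<forall>\<delta>. 0 < \<delta> \<and> \<delta> < \<epsilon> \<longrightarrow> \<phi> \<delta> z \<in> W" by (rule bspec)
  qed
qed

section \<open>Invariance\<close>

text \<open>Push-forward invariance gives the measure of the preimage directly. In the pull-back
  sense the measure of a set of preimages is the integral of a multiplicity function that vanishes
  off the null set \<open>W\<close>.\<close>

lemma preserves_measure_preimage_null:
  assumes inv: "preserves_measure \<mu> S \<phi> \<Delta>" and t: "0 \<le> t" and W: "W \<in> null_sets \<mu>"
  shows "{x \<in> completed_dom S \<phi> \<Delta> t. completed_flow S \<phi> \<Delta> t x \<in> W} \<in> null_sets (completion \<mu>)"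
    (is "?P \<in> _")
proof -
  have P: "?P \<in> sets (completion \<mu>)"
    using inv t W unfolding preserves_measure_def hflow_measurable_def by auto
  from inv consider "push_forward_invariant \<mu> S \<phi> \<Delta>" | "pull_back_invariant \<mu> S \<phi> \<Delta>"
    unfolding preserves_measure_def by blast
  then show ?thesis
  proof cases
    case 1
    then have "emeasure (completion \<mu>) ?P = emeasure \<mu> W"
      using t W unfolding push_forward_invariant_def by auto
    then show ?thesis using P null_setsD1[OF W] by (intro null_setsI) simp_all
  next
    case 2
    \<comment> \<open>Pull-back invariance is stated for sets of \<open>\<mu>\<close>, while
      \<open>?P\<close> is measurable only for the completion; its main part is such a set, lies in
      \<open>?P\<close> and has the same measure.\<close>
    define B where "B = main_part \<mu> ?P"
    have B: "B \<in> sets \<mu>" "B \<subseteq> ?P"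
      using main_part_sets[OF P] main_part_null_part_Un[OF P] unfolding B_def by blast+
    have "emeasure \<mu> B =
        (\<integral>\<^sup>+y. emeasure (count_space UNIV) {x \<in> B. completed_flow S \<phi> \<Delta> t x = y} \<partial>completion \<mu>)"
    proof -
      have "B \<subseteq> completed_dom S \<phi> \<Delta> t" using B(2) by blast
      then show ?thesis using 2 t B(1) unfolding pull_back_invariant_def by simp
    qed
    also have "\<dots> = (\<integral>\<^sup>+y. 0 \<partial>completion \<mu>)"
    proof (rule nn_integral_cong_AE)
      have "emeasure (count_space UNIV) {x \<in> B. completed_flow S \<phi> \<Delta> t x = y} = 0"
        if "y \<notin> W" for y
      proof -
        have "{x \<in> B. completed_flow S \<phi> \<Delta> t x = y} = {}" using B(2) that by auto
        then show ?thesis by (simp only: emeasure_empty)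
      qed
      then show "AE y in completion \<mu>.
          emeasure (count_space UNIV) {x \<in> B. completed_flow S \<phi> \<Delta> t x = y} = 0"
        using AE_not_in[OF null_sets_completionI[OF W]] by (auto elim!: eventually_mono)
    qed
    finally have "emeasure (completion \<mu>) ?P = 0"
      using P by (simp add: B_def emeasure_completion)
    then show ?thesis using P by auto
  qed
qed

theorem theorem6p3:
  fixes A :: "('a::{t2_space, second_countable_topology}, 'b::euclidean_space) chart set"
    and S :: "'a set"
    and X :: "('a, 'b) chart \<Rightarrow> 'a \<Rightarrow> 'b"
    and \<Delta> :: "'a \<Rightarrow> 'a"
    and \<phi> :: "real \<Rightarrow> 'a \<Rightarrow> 'a"
    and \<mu> :: "'a measure"
  assumes "compact (UNIV :: 'a set)"
    and "is_flow A X \<phi>"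
    and "smooth_hybrid_system A S X \<Delta> \<phi>"
    and "boundary_identity S \<Delta>"
    and "smooth_measure A \<mu>"
    and "preserves_measure \<mu> S \<phi> \<Delta>"
  shows "junction_reaching S \<phi> \<Delta> \<in> null_sets (completion \<mu>)"
proof -
  have "smooth_structure A" "smooth_vector_field A X" "codim_at_least_2 A (junction S \<Delta>)"
    using assms(3) unfolding smooth_hybrid_system_def hybrid_system_def by blast+
  then obtain W where W: "W \<in> null_sets \<mu>"
    "\<And>z. z \<in> junction S \<Delta> \<Longrightarrow> \<exists>\<epsilon>>0. \<forall>\<delta>. 0 < \<delta> \<and> \<delta> < \<epsilon> \<longrightarrow> \<phi> \<delta> z \<in> W"
    using flow_out_null[of A X \<phi> \<mu> "junction S \<Delta>"] assms(2,5) by metis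
  let ?P = "\<lambda>T. {x \<in> completed_dom S \<phi> \<Delta> T. completed_flow S \<phi> \<Delta> T x \<in> W}"
  have "junction_reaching S \<phi> \<Delta> \<subseteq> (\<Union>T\<in>\<rat> \<inter> {0..}. ?P T)"
  proof
    fix x assume "x \<in> junction_reaching S \<phi> \<Delta>"
    from junction_reaching_continue[OF assms(3,4) this]
    obtain t z \<epsilon> where z: "z \<in> junction S \<Delta>" "t > 0" "\<epsilon> > 0"
      "\<And>\<delta>. 0 < \<delta> \<Longrightarrow> \<delta> < \<epsilon> \<Longrightarrow> x \<in> completed_dom S \<phi> \<Delta> (t + \<delta>)"
      "\<And>\<delta>. 0 < \<delta> \<Longrightarrow> \<delta> < \<epsilon> \<Longrightarrow> completed_flow S \<phi> \<Delta> (t + \<delta>) x = \<phi> \<delta> z"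
      by metis
    obtain \<epsilon>' where e': "\<epsilon>' > 0" "\<And>\<delta>. 0 < \<delta> \<Longrightarrow> \<delta> < \<epsilon>' \<Longrightarrow> \<phi> \<delta> z \<in> W" using W(2)[OF z(1)] by blast
    \<comment> \<open>Below \<open>\<epsilon>\<close> the completed flow after arrival is
      \<open>\<phi> \<delta> z\<close>; below \<open>\<epsilon>'\<close> that point lies in
      \<open>W\<close>.\<close>
    obtain T where T: "T \<in> \<rat>" "t < T" "T < t + min \<epsilon> \<epsilon>'"
      using Rats_dense_in_real[of t "t + min \<epsilon> \<epsilon>'"] z(3) e'(1) by auto
    then have "x \<in> ?P T" using z(4,5)[of "T - t"] e'(2)[of "T - t"] by simp
    then show "x \<in> (\<Union>T\<in>\<rat> \<inter> {0..}. ?P T)" using T z(2) by (intro UN_I[of T]) auto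
  qed
  moreover have "(\<Union>T\<in>\<rat> \<inter> {0..}. ?P T) \<in> null_sets (completion \<mu>)"
    using preserves_measure_preimage_null[OF assms(6) _ W(1)] countable_rat
    by (intro null_sets_UN') (auto intro: countable_Int1)
  \<comment> \<open>Subsets of null sets are measurable and null in the completion, which settles
    measurability of the set as well.\<close>
  ultimately show ?thesis using null_sets_completion_subset by blast
qed

end
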